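(* Let $Q$ be a directed set that is a countable union of $\omega_1$-directed sets. Then $\langle\mathcal U,\supseteq^*\rangle\not\equiv_T\omega\times Q$ for every nonprincipal ultrafilter $\mathcal U$ on $\omega$.
   Context: A quasiorder is a set with a reflexive transitive relation $\leq$. A quasiorder is $\kappa$-directed if every subset of size less than $\kappa$ has an upper bound in it; directed means $\omega$-directed. "$Q$ is a countable union of $\omega_1$-directed sets" means $Q=\bigcup_{n<\omega}Q_n$ where each $Q_n\subseteq Q$, with the order inherited from $Q$, is $\omega_1$-directed. The product $P\times Q$ of quasiorders is ordered coordinatewise: $\langle p_0,q_0\rangle\leq\langle p_1,q_1\rangle$ iff $p_0\leq p_1$ and $q_0\leq q_1$; $\omega$ has its usual order. For directed sets $P,Q$, a map $f\colon P\to Q$ is Tukey if the $f$-image of every unbounded subset of $P$ is unbounded in $Q$; $P\leq_T Q$ means a Tukey map $P\to Q$ exists; $P\equiv_T Q$ means $P\leq_T Q\leq_T P$. $A\supseteq^* B$ means $B\setminus A$ is finite. $\langle\mathcal U,\supseteq^*\rangle$ denotes $\mathcal U$ quasiordered so that $A\leq B$ iff $A\supseteq^* B$. *)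

theory Defs
  imports Main
begin

text \<open>
  A quasiordered set is given by a carrier \<open>P\<close> together with a relation \<open>le\<close> on the
  ambient type; only the restriction of \<open>le\<close> to \<open>P\<close> matters. In particular a subset
  \<open>P' \<subseteq> P\<close> with the same \<open>le\<close> carries the inherited order.
\<close>

definition quasiorder_on :: "'a set \<Rightarrow> ('a \<Rightarrow> 'a \<Rightarrow> bool) \<Rightarrow> bool" where
  "quasiorder_on P le \<longleftrightarrow> reflp_on P le \<and> transp_on P le"

definition bounded_in :: "'a set \<Rightarrow> ('a \<Rightarrow> 'a \<Rightarrow> bool) \<Rightarrow> 'a set \<Rightarrow> bool" where
  "bounded_in P le X \<longleftrightarrow> (\<exists>u\<in>P. \<forall>x\<in>X. le x u)"

text \<open>
  The cardinal \<open>\<kappa>\<close> is a well-order relation, as in the cardinals library. The empty set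
  has size less than \<open>\<kappa>\<close> for \<open>\<kappa> > 0\<close>, so such \<open>\<kappa>\<close>-directed sets are nonempty.
\<close>

definition card_directed_on :: "'k rel \<Rightarrow> 'a set \<Rightarrow> ('a \<Rightarrow> 'a \<Rightarrow> bool) \<Rightarrow> bool"
  where
  "card_directed_on \<kappa> P le \<longleftrightarrow>
     quasiorder_on P le \<and> (\<forall>X\<subseteq>P. (card_of X, \<kappa>) \<in> ordLess \<longrightarrow> bounded_in P le X)"

abbreviation directed_on :: "'a set \<Rightarrow> ('a \<Rightarrow> 'a \<Rightarrow> bool) \<Rightarrow> bool" where
  "directed_on \<equiv> card_directed_on natLeq"

abbreviation omega1_directed_on :: "'a set \<Rightarrow> ('a \<Rightarrow> 'a \<Rightarrow> bool) \<Rightarrow> bool" where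
  "omega1_directed_on \<equiv> card_directed_on (cardSuc natLeq)"

definition countable_union_omega1_directed ::
    "'a set \<Rightarrow> ('a \<Rightarrow> 'a \<Rightarrow> bool) \<Rightarrow> bool" where
  "countable_union_omega1_directed Q le \<longleftrightarrow>
     (\<exists>Qs :: nat \<Rightarrow> 'a set. Q = (\<Union>n. Qs n) \<and> (\<forall>n. omega1_directed_on (Qs n) le))"

definition tukey_map ::
    "'a set \<Rightarrow> ('a \<Rightarrow> 'a \<Rightarrow> bool) \<Rightarrow> 'b set \<Rightarrow> ('b \<Rightarrow> 'b \<Rightarrow> bool) \<Rightarrow> ('a \<Rightarrow> 'b) \<Rightarrow> bool"
  where
  "tukey_map P leP Q leQ f \<longleftrightarrow>
     f ` P \<subseteq> Q \<and> (\<forall>X\<subseteq>P. \<not> bounded_in P leP X \<longrightarrow> \<not> bounded_in Q leQ (f ` X))"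

definition tukey_le ::
    "'a set \<Rightarrow> ('a \<Rightarrow> 'a \<Rightarrow> bool) \<Rightarrow> 'b set \<Rightarrow> ('b \<Rightarrow> 'b \<Rightarrow> bool) \<Rightarrow> bool" where
  "tukey_le P leP Q leQ \<longleftrightarrow> (\<exists>f. tukey_map P leP Q leQ f)"

definition tukey_equiv ::
    "'a set \<Rightarrow> ('a \<Rightarrow> 'a \<Rightarrow> bool) \<Rightarrow> 'b set \<Rightarrow> ('b \<Rightarrow> 'b \<Rightarrow> bool) \<Rightarrow> bool" where
  "tukey_equiv P leP Q leQ \<longleftrightarrow> tukey_le P leP Q leQ \<and> tukey_le Q leQ P leP"

definition ultrafilter :: "'a set set \<Rightarrow> bool" where
  "ultrafilter U \<longleftrightarrow>
     UNIV \<in> U \<and> {} \<notin> U \<and>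
     (\<forall>A B. A \<in> U \<longrightarrow> A \<subseteq> B \<longrightarrow> B \<in> U) \<and>
     (\<forall>A B. A \<in> U \<longrightarrow> B \<in> U \<longrightarrow> A \<inter> B \<in> U) \<and>
     (\<forall>A. A \<in> U \<or> - A \<in> U)"

definition nonprincipal_ultrafilter :: "'a set set \<Rightarrow> bool" where
  "nonprincipal_ultrafilter U \<longleftrightarrow> ultrafilter U \<and> (\<nexists>x. U = {A. x \<in> A})"

text \<open>\<open>A \<supseteq>\<^sup>* B\<close>; as an order relation, \<open>A\<close> is below \<open>B\<close>.\<close>

definition almost_superset :: "'a set \<Rightarrow> 'a set \<Rightarrow> bool" where
  "almost_superset A B \<longleftrightarrow> finite (B - A)"

end

theory Submission
  imports Defs "HOL-Library.Countable_Set_Type"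
begin

text \<open>
  If \<open>U\<close> were equivalent to \<open>\<omega> \<times> Q\<close>, then \<open>U\<close> would be a union of countably many pieces \<open>F i\<close>
  all of whose countable subsets are bounded, and yet some sequence \<open>A n\<close> in \<open>U\<close>, without
  loss of generality decreasing to the empty set, would be unbounded. The fibres of the map \<open>f\<close> sending \<open>k\<close> to the first \<open>n\<close> with \<open>k \<notin> A n\<close> are then not
  in \<open>U\<close>, and every member of \<open>U\<close> meets \<open>f(U)\<close>-many fibres in an infinite set. Consequently a
  bound in \<open>U\<close> for sets \<open>f -` B\<close> with \<open>B \<in> f(U)\<close> produces a member of \<open>f(U)\<close> that is contained
  in each of these \<open>B\<close> outright, not just modulo finite sets. As every
  intersection of sets of natural numbers is already that of countably many of them, each \<open>F i\<close>
  contributes a single generator, so \<open>f(U)\<close> has a countable base, which is impossible for a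
  nonprincipal ultrafilter.
\<close>

lemma ultrafilterD:
  assumes "ultrafilter U"
  shows "UNIV \<in> U" "{} \<notin> U" "A \<in> U \<Longrightarrow> A \<subseteq> B \<Longrightarrow> B \<in> U" "A \<in> U \<Longrightarrow> B \<in> U \<Longrightarrow> A \<inter> B \<in> U"
    "A \<notin> U \<Longrightarrow> - A \<in> U"
  using assms by (simp_all add: ultrafilter_def) metis+

lemma ultrafilter_Compl_iff:
  assumes "ultrafilter U"
  shows "- A \<in> U \<longleftrightarrow> A \<notin> U"
proof
  assume "- A \<in> U"
  show "A \<notin> U"
  proof
    assume "A \<in> U"
    then have "A \<inter> - A \<in> U" using \<open>- A \<in> U\<close> by (rule ultrafilterD(4)[OF assms])
    then show False using ultrafilterD(2)[OF assms] by simp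
  qed
qed (rule ultrafilterD(5)[OF assms])

lemma ultrafilter_Int_iff:
  assumes "ultrafilter U"
  shows "A \<inter> B \<in> U \<longleftrightarrow> A \<in> U \<and> B \<in> U"
proof
  assume "A \<inter> B \<in> U"
  then show "A \<in> U \<and> B \<in> U"
    by (intro conjI ultrafilterD(3)[OF assms \<open>A \<inter> B \<in> U\<close>]) simp_all
qed (simp add: ultrafilterD(4)[OF assms])

lemma ultrafilter_INT_finite:
  assumes "ultrafilter U" "finite I" "\<And>i. i \<in> I \<Longrightarrow> A i \<in> U"
  shows "(\<Inter>i\<in>I. A i) \<in> U"
  using assms(2,3) by induction (simp_all add: ultrafilterD(1)[OF assms(1)] ultrafilter_Int_iff[OF assms(1)])

lemma ultrafilter_singleton_iff:
  assumes "ultrafilter U"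
  shows "{x} \<in> U \<longleftrightarrow> U = {A. x \<in> A}"
proof
  assume x: "{x} \<in> U"
  have "A \<in> U \<longleftrightarrow> x \<in> A" for A
    using ultrafilterD(2)[OF assms] ultrafilterD(3)[OF assms x, of A] ultrafilterD(4)[OF assms x, of A]
    by (cases "x \<in> A") auto
  then show "U = {A. x \<in> A}" by blast
qed blast

lemma nonprincipal_ultrafilter_iff:
  "nonprincipal_ultrafilter U \<longleftrightarrow> ultrafilter U \<and> (\<forall>x. {x} \<notin> U)"
  by (simp add: nonprincipal_ultrafilter_def ultrafilter_singleton_iff cong: conj_cong)

lemma nonprincipal_ultrafilter_infinite:
  assumes "nonprincipal_ultrafilter U" "A \<in> U"
  shows "infinite A"
proof
  assume "finite A"
  have U: "ultrafilter U" and sing: "\<And>x. {x} \<notin> U"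
    using assms(1) by (simp_all add: nonprincipal_ultrafilter_iff)
  have "(\<Inter>x\<in>A. - {x}) \<in> U"
    using \<open>finite A\<close> sing by (intro ultrafilter_INT_finite U) (simp_all add: ultrafilter_Compl_iff[OF U])
  moreover have "(\<Inter>x\<in>A. - {x}) = - A" by blast
  ultimately show False
    using assms(2) ultrafilter_Compl_iff[OF U] by simp
qed

lemma ultrafilter_pushforward:
  assumes "ultrafilter U"
  shows "ultrafilter {B. f -` B \<in> U}"
  unfolding ultrafilter_def mem_Collect_eq
proof (intro conjI allI impI)
  fix A B assume "f -` A \<in> U" "A \<subseteq> B"
  then show "f -` B \<in> U" by (rule ultrafilterD(3)[OF assms _ vimage_mono])
next
  fix A B assume "f -` A \<in> U" "f -` B \<in> U"
  then show "f -` (A \<inter> B) \<in> U" by (simp add: ultrafilter_Int_iff[OF assms])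
qed (simp_all add: ultrafilterD(1,2)[OF assms] vimage_Compl ultrafilter_Compl_iff[OF assms])

text \<open>Distinct points \<open>c n\<close> are chosen recursively, with \<open>c (2 * i)\<close>
  and \<open>c (2 * i + 1)\<close> both in \<open>W i\<close>. The even-indexed points form
  \<open>X\<close>, so each \<open>W i\<close> has a point inside and one outside.\<close>

lemma infinite_sets_split:
  fixes W :: "nat \<Rightarrow> 'a set"
  assumes "\<And>i. infinite (W i)"
  obtains X where "\<And>i. W i \<inter> X \<noteq> {}" "\<And>i. W i - X \<noteq> {}"
proof -
  have "\<exists>c. \<forall>n. c n \<in> W (n div 2) - c ` {..<n}"
  proof (rule dependent_wellorder_choice)
    show "\<exists>r. r \<in> W (n div 2) - c ` {..<n}" for n and c :: "nat \<Rightarrow> 'a"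
      using Diff_infinite_finite[of "c ` {..<n}" "W (n div 2)"] assms infinite_imp_nonempty by blast
  next
    fix r and c d :: "nat \<Rightarrow> 'a" and n :: nat
    assume "\<And>m. m < n \<Longrightarrow> c m = d m"
    then have "c ` {..<n} = d ` {..<n}" by (intro image_cong) auto
    then show "r \<in> W (n div 2) - c ` {..<n} \<longleftrightarrow> r \<in> W (n div 2) - d ` {..<n}" by simp
  qed
  then obtain c where c: "\<And>n. c n \<in> W (n div 2)" and fresh: "\<And>m n. m < n \<Longrightarrow> c n \<noteq> c m"
    by (auto simp: image_iff)
  have inj: "c m = c n \<Longrightarrow> m = n" for m n
    using fresh by (metis linorder_neqE_nat)
  show thesis
  proof
    fix i
    show "W i \<inter> c ` {n. even n} \<noteq> {}"
      using c[of "2 * i"] by auto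
    have "c (2 * i + 1) \<notin> c ` {n. even n}"
      using inj by fastforce
    then show "W i - c ` {n. even n} \<noteq> {}"
      using c[of "2 * i + 1"] by auto
  qed
qed

text \<open>Some \<open>X\<close> splits every \<open>W i\<close>. Either \<open>X\<close> or its
  complement lies in \<open>U\<close>, and neither includes any \<open>W i\<close>.\<close>

lemma nonprincipal_ultrafilter_no_countable_base:
  fixes W :: "nat \<Rightarrow> 'a set"
  assumes "nonprincipal_ultrafilter U" "\<And>i. W i \<in> U"
  obtains B where "B \<in> U" "\<And>i. \<not> W i \<subseteq> B"
proof -
  obtain X where X: "\<And>i. W i \<inter> X \<noteq> {}" "\<And>i. W i - X \<noteq> {}"
    using infinite_sets_split nonprincipal_ultrafilter_infinite assms by metis
  have "X \<in> U \<or> - X \<in> U"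
    using assms(1) ultrafilterD(5) by (auto simp: nonprincipal_ultrafilter_def)
  then show thesis
    using that[of X] that[of "- X"] X by blast
qed

text \<open>One member per point outside the intersection is enough to exclude that point, and the
  type has only countably many points.\<close>

lemma countable_INT_subfamily:
  fixes \<B> :: "'a :: countable set set"
  obtains \<C> where "\<C> \<subseteq> \<B>" "countable \<C>" "\<Inter>\<C> = \<Inter>\<B>"
proof -
  have "\<forall>x\<in>- \<Inter>\<B>. \<exists>B. B \<in> \<B> \<and> x \<notin> B" by blast
  then obtain b where b: "\<forall>x\<in>- \<Inter>\<B>. b x \<in> \<B> \<and> x \<notin> b x" by metis
  show thesis
  proof
    show "b ` (- \<Inter>\<B>) \<subseteq> \<B>" using b by blast
    show "countable (b ` (- \<Inter>\<B>))" by simp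
    show "\<Inter>(b ` (- \<Inter>\<B>)) = \<Inter>\<B>" using b by blast
  qed
qed

text \<open>
  The condition \<open>k \<notin> A' k\<close> guarantees that \<open>LEAST n. k \<notin> A' n\<close> is well defined for every \<open>k\<close>.
\<close>

lemma unbounded_sequence_decreasing:
  fixes U :: "nat set set" and A :: "nat \<Rightarrow> nat set"
  assumes U: "nonprincipal_ultrafilter U"
    and A: "range A \<subseteq> U" "\<not> bounded_in U almost_superset (range A)"
  obtains A' :: "nat \<Rightarrow> nat set" where "range A' \<subseteq> U" "antimono A'" "\<And>k. k \<notin> A' k"
    "\<not> bounded_in U almost_superset (range A')"
proof
  \<comment> \<open>Removing \<open>{..i}\<close> excludes \<open>k\<close> from the
    \<open>k\<close>-th set and stays within \<open>U\<close>, which contains no finite set.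
    Intersecting makes the sequence decrease.\<close>
  let ?A = "\<lambda>n. (\<Inter>i\<in>{..n}. A i - {..i})"
  have uf: "ultrafilter U" using U by (simp add: nonprincipal_ultrafilter_def)
  have "A n - {..n} \<in> U" for n
    unfolding Diff_eq ultrafilter_Int_iff[OF uf] ultrafilter_Compl_iff[OF uf]
    using A(1) nonprincipal_ultrafilter_infinite[OF U, of "{..n}"] by blast
  then show "range ?A \<subseteq> U" by (auto intro!: ultrafilter_INT_finite[OF uf])
  show "antimono ?A" by (intro antimonoI) force
  show "k \<notin> ?A k" for k by blast
  show "\<not> bounded_in U almost_superset (range ?A)"
  proof
    assume "bounded_in U almost_superset (range ?A)"
    then obtain C where C: "C \<in> U" "\<And>n. finite (C - ?A n)"
      by (auto simp: bounded_in_def almost_superset_def)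
    have "C - A n \<subseteq> C - ?A n" for n by blast
    then have "finite (C - A n)" for n using C(2) finite_subset by blast
    then show False using A(2) C(1) by (auto simp: bounded_in_def almost_superset_def)
  qed
qed

text \<open>The \<open>F i\<close> stand for the preimages of the sets
  \<open>{n} \<times> Qs m\<close> under a Tukey map defined on \<open>U\<close>. The conclusion
  conflicts with a Tukey map in the other direction, which keeps an unbounded sequence
  unbounded.\<close>

lemma nonprincipal_ultrafilter_bounded_sequences:
  fixes U :: "nat set set" and F :: "nat \<Rightarrow> nat set set" and A :: "nat \<Rightarrow> nat set"
  assumes U: "nonprincipal_ultrafilter U"
    and cover: "U \<subseteq> (\<Union>i. F i)"
    and bdd: "\<And>i X. X \<subseteq> F i \<inter> U \<Longrightarrow> countable X \<Longrightarrow> bounded_in U almost_superset X"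
    and A: "range A \<subseteq> U"
  shows "bounded_in U almost_superset (range A)"
proof (rule ccontr)
  assume "\<not> bounded_in U almost_superset (range A)"
  then obtain D :: "nat \<Rightarrow> nat set" where D: "range D \<subseteq> U" "antimono D" "\<And>k. k \<notin> D k"
    and unbdd: "\<not> bounded_in U almost_superset (range D)"
    using unbounded_sequence_decreasing[OF U A] by metis
  have uf: "ultrafilter U" using U by (simp add: nonprincipal_ultrafilter_def)
  define f where "f k = (LEAST n. k \<notin> D n)" for k
  \<comment> \<open>As \<open>D\<close> decreases, the complement of \<open>D n\<close> is the union
    of the fibres over \<open>m \<le> n\<close>.\<close>
  have f_le: "f k \<le> n \<longleftrightarrow> k \<notin> D n" for k n
  proof
    have "k \<notin> D (f k)" unfolding f_def by (rule LeastI) (rule D(3))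
    then show "f k \<le> n \<Longrightarrow> k \<notin> D n" using antimonoD[OF D(2)] by blast
  qed (auto simp: f_def intro: Least_le)
  define V where "V = {B. f -` B \<in> U}"
  have ufV: "ultrafilter V" unfolding V_def by (rule ultrafilter_pushforward[OF uf])
  have "{n} \<notin> V" for n
  proof
    assume "{n} \<in> V"
    moreover have "D n \<in> U" using D(1) by blast
    ultimately have "f -` {n} \<inter> D n \<in> U" using ultrafilterD(4)[OF uf] by (simp add: V_def)
    moreover have "f -` {n} \<inter> D n = {}" using f_le by fastforce
    ultimately show False using ultrafilterD(2)[OF uf] by simp
  qed
  with ufV have V: "nonprincipal_ultrafilter V" by (simp add: nonprincipal_ultrafilter_iff)
  \<comment> \<open>Otherwise the part of \<open>C\<close> in fibres that it meets finitely is in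
    \<open>U\<close>. Only finitely many of these fibres lie outside a given \<open>D n\<close>, so
    that part would bound \<open>range D\<close>.\<close>
  have inf_fibres: "{n. infinite (C \<inter> f -` {n})} \<in> V" if C: "C \<in> U" for C
  proof (rule ccontr)
    assume "{n. infinite (C \<inter> f -` {n})} \<notin> V"
    then have "- {n. infinite (C \<inter> f -` {n})} \<in> V" by (rule ultrafilterD(5)[OF ufV])
    then have "C \<inter> f -` {n. finite (C \<inter> f -` {n})} \<in> U"
      using ultrafilterD(4)[OF uf C] by (simp add: V_def Compl_eq)
    moreover have "finite (C \<inter> f -` {n. finite (C \<inter> f -` {n})} - D n)" for n
    proof (rule finite_subset)
      show "C \<inter> f -` {n. finite (C \<inter> f -` {n})} - D n
          \<subseteq> (\<Union>m\<in>{m. m \<le> n \<and> finite (C \<inter> f -` {m})}. C \<inter> f -` {m})"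
        using f_le by auto
      show "finite (\<Union>m\<in>{m. m \<le> n \<and> finite (C \<inter> f -` {m})}. C \<inter> f -` {m})"
        by (rule finite_UN_I) auto
    qed
    ultimately show False using unbdd by (auto simp: bounded_in_def almost_superset_def)
  qed
  define W where "W i = \<Inter>{B \<in> V. f -` B \<in> F i}" for i
  have "W i \<in> V" for i
  proof -
    \<comment> \<open>The hypothesis \<open>bdd\<close> covers only countable families, so
      \<open>W i\<close> is first written as a countable intersection.\<close>
    obtain \<C> where \<C>: "\<C> \<subseteq> {B \<in> V. f -` B \<in> F i}" "countable \<C>" "\<Inter>\<C> = W i"
      unfolding W_def by (rule countable_INT_subfamily)
    have "bounded_in U almost_superset ((-`) f ` \<C>)"
      using \<C> by (intro bdd[of _ i]) (auto simp: V_def)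
    then obtain C where C: "C \<in> U" "\<And>B. B \<in> \<C> \<Longrightarrow> finite (C - f -` B)"
      by (auto simp: bounded_in_def almost_superset_def)
    \<comment> \<open>A fibre lies wholly inside or wholly outside the preimage of \<open>B\<close>.
      If outside, its trace on \<open>C\<close> is finite.\<close>
    have "{n. infinite (C \<inter> f -` {n})} \<subseteq> B" if "B \<in> \<C>" for B
    proof (rule subsetI, rule ccontr)
      fix n assume n: "n \<in> {n. infinite (C \<inter> f -` {n})}" "n \<notin> B"
      then have "C \<inter> f -` {n} \<subseteq> C - f -` B" by auto
      then show False using C(2)[OF that] n(1) finite_subset by blast
    qed
    then have "{n. infinite (C \<inter> f -` {n})} \<subseteq> W i" unfolding \<C>(3)[symmetric] by (rule Inter_greatest)
    with inf_fibres[OF C(1)] show ?thesis by (rule ultrafilterD(3)[OF ufV])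
  qed
  then obtain B where B: "B \<in> V" "\<And>i. \<not> W i \<subseteq> B"
    using nonprincipal_ultrafilter_no_countable_base[OF V, of W] by metis
  obtain i where "f -` B \<in> F i" using B(1) cover by (auto simp: V_def)
  then have "W i \<subseteq> B" using B(1) by (auto simp: W_def)
  then show False using B(2) by blast
qed

lemma omega1_directed_on_countable_bounded:
  assumes "omega1_directed_on P le" "X \<subseteq> P" "countable X"
  shows "bounded_in P le X"
proof -
  have "(card_of X, natLeq) \<in> ordLeq"
    using assms(3) by (simp add: countable_card_le_natLeq)
  then have "(card_of X, cardSuc natLeq) \<in> ordLess"
    using cardSuc_greater[OF natLeq_Card_order] ordLeq_ordLess_trans by blast
  then show ?thesis using assms(1,2) by (simp add: card_directed_on_def)
qed

lemma tukey_mapD: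
  assumes "tukey_map P leP Q leQ f"
  shows "x \<in> P \<Longrightarrow> f x \<in> Q" "X \<subseteq> P \<Longrightarrow> bounded_in Q leQ (f ` X) \<Longrightarrow> bounded_in P leP X"
  using assms by (auto simp: tukey_map_def)

theorem theorem3p13:
  fixes Q :: "'a set" and le :: "'a \<Rightarrow> 'a \<Rightarrow> bool"
    and U :: "nat set set"
  assumes "directed_on Q le"
    and "countable_union_omega1_directed Q le"
    and "nonprincipal_ultrafilter U"
  shows "\<not> tukey_equiv U almost_superset ((UNIV :: nat set) \<times> Q) (rel_prod (\<le>) le)"
proof
  assume "tukey_equiv U almost_superset ((UNIV :: nat set) \<times> Q) (rel_prod (\<le>) le)"
  then obtain h g
    where h: "tukey_map U almost_superset ((UNIV :: nat set) \<times> Q) (rel_prod (\<le>) le) h"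
      and g: "tukey_map ((UNIV :: nat set) \<times> Q) (rel_prod (\<le>) le) U almost_superset g"
    by (auto simp: tukey_equiv_def tukey_le_def)
  obtain Qs :: "nat \<Rightarrow> 'a set" where Q: "Q = (\<Union>n. Qs n)" and Qs: "\<And>n. omega1_directed_on (Qs n) le"
    using assms(2) by (auto simp: countable_union_omega1_directed_def)
  \<comment> \<open>A bound of the empty set is a point of \<open>Qs 0\<close>, so \<open>Q\<close>
    is nonempty.\<close>
  have "bounded_in (Qs 0) le {}"
    by (rule omega1_directed_on_countable_bounded[OF Qs]) simp_all
  then obtain q where q: "q \<in> Q"
    using Q by (auto simp: bounded_in_def)
  \<comment> \<open>Fixing the first coordinate at \<open>n\<close> bounds it trivially, leaving
    only \<open>Qs m\<close> to supply a bound.\<close>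
  define F where "F i = (case prod_decode i of (n, m) \<Rightarrow> {A. h A \<in> {n} \<times> Qs m})" for i
  have "bounded_in U almost_superset (range (\<lambda>n. g (n, q)))"
  proof (rule nonprincipal_ultrafilter_bounded_sequences[OF assms(3)])
    show "U \<subseteq> (\<Union>i. F i)"
    proof
      fix A assume "A \<in> U"
      then obtain n m where "h A \<in> {n} \<times> Qs m"
        using tukey_mapD(1)[OF h] Q by (cases "h A") fastforce
      then have "A \<in> F (prod_encode (n, m))" by (simp add: F_def)
      then show "A \<in> (\<Union>i. F i)" by blast
    qed
  next
    fix i X assume X: "X \<subseteq> F i \<inter> U" "countable X"
    obtain n m where nm: "prod_decode i = (n, m)" by fastforce
    have hX: "h A \<in> {n} \<times> Qs m" if "A \<in> X" for A
      using that X(1) nm by (auto simp: F_def)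
    then have "bounded_in (Qs m) le (snd ` h ` X)"
      using X(2) by (intro omega1_directed_on_countable_bounded[OF Qs]) force+
    then obtain u where u: "u \<in> Q" "\<And>A. A \<in> X \<Longrightarrow> le (snd (h A)) u"
      using Q by (auto simp: bounded_in_def)
    have "rel_prod (\<le>) le (h A) (n, u)" if "A \<in> X" for A
      using hX[OF that] u(2)[OF that] by (cases "h A") auto
    then have "bounded_in (UNIV \<times> Q) (rel_prod (\<le>) le) (h ` X)"
      using u(1) unfolding bounded_in_def by blast
    then show "bounded_in U almost_superset X" using X(1) by (intro tukey_mapD(2)[OF h]) auto
  next
    show "range (\<lambda>n. g (n, q)) \<subseteq> U" using tukey_mapD(1)[OF g] q by auto
  qed
  then have "bounded_in U almost_superset (g ` range (\<lambda>n. (n, q)))" by (simp add: image_image)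
  then have "bounded_in ((UNIV :: nat set) \<times> Q) (rel_prod (\<le>) le) (range (\<lambda>n. (n, q)))"
    using q by (intro tukey_mapD(2)[OF g]) auto
  then obtain N where "\<And>n. n \<le> (N :: nat)" by (fastforce simp: bounded_in_def)
  then show False using not_less_eq_eq by blast
qed

end
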